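(* Two r.e. sets belonging to the same one-reducibility equivalence class need not belong to the same uniformity equivalence class; that is, there exist r.e. sets $A,B\subseteq\mathbb{N}$ such that $A\equiv_1 B$ but $A\not\sim B$.
   Context: $\mathbb{N}=\{1,2,3,\dots\}$. $A\equiv_1 B$ means that $A$ and $B$ are one-one reducible to each other (via total injective computable functions). A listing of an r.e. set $A\subseteq\mathbb{N}$ is a bijective computable function onto $A$: if $A$ is infinite it is a total computable bijection $h:\mathbb{N}\to A$; if $A$ is finite with $n$ elements it is a bijection $h:\{1,\dots,n\}\to A$. Two listings $h,g$ with the same domain are uniform, $h\sim g$, if $h(i)<h(j)\Leftrightarrow g(i)<g(j)$ for all $i,j$ in the domain. Two r.e. sets $A,B$ of equal cardinality are uniform, $A\sim B$, if there exist a listing $h$ of $A$ and a listing $g$ of $B$ with $h\sim g$. The uniformity equivalence class of $A$ is $[A]_\sim=\{B\subseteq\mathbb{N}: A\sim B\}$. *)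

theory Defs
  imports Main "HOL-Library.Equipollence"
begin

section \<open>Partial recursive functions\<close>

datatype recf =
    Zero
  | Succ
  | Proj nat
  | Comp recf "recf list"
  | PrimRec recf recf
  | Mu recf

text \<open>
  \<open>evaluates p xs y\<close> means that the \<open>\<mu>\<close>-recursive term \<open>p\<close>, applied to the argument tuple \<open>xs\<close>,
  is defined with value \<open>y\<close>. Terms carry no fixed arity: \<open>Zero\<close> accepts any argument list, and other
  terms have no value on lists that do not fit. For each \<open>k\<close>, the partial functions given by terms on lists of length \<open>k\<close> are the
  \<open>k\<close>-ary partial recursive functions. The recursion variable and the variable of minimisation
  come first. Minimisation requires all earlier values to be defined and nonzero.
\<close>

inductive evaluates :: "recf \<Rightarrow> nat list \<Rightarrow> nat \<Rightarrow> bool" where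
  zero: "evaluates Zero xs 0"
| succ: "evaluates Succ [x] (Suc x)"
| proj: "i < length xs \<Longrightarrow> evaluates (Proj i) xs (xs ! i)"
| comp: "list_all2 (\<lambda>q y. evaluates q xs y) qs ys \<Longrightarrow> evaluates p ys z
           \<Longrightarrow> evaluates (Comp p qs) xs z"
| primrec_0: "evaluates p xs y \<Longrightarrow> evaluates (PrimRec p q) (0 # xs) y"
| primrec_Suc: "evaluates (PrimRec p q) (n # xs) r \<Longrightarrow> evaluates q (n # r # xs) y
           \<Longrightarrow> evaluates (PrimRec p q) (Suc n # xs) y"
| mu: "evaluates p (n # xs) 0 \<Longrightarrow> (\<forall>m<n. \<exists>y. evaluates p (m # xs) (Suc y))
           \<Longrightarrow> evaluates (Mu p) xs n"

inductive_cases evaluates_ZeroE: "evaluates Zero xs y"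
inductive_cases evaluates_SuccE: "evaluates Succ xs y"
inductive_cases evaluates_ProjE: "evaluates (Proj i) xs y"
inductive_cases evaluates_CompE: "evaluates (Comp p qs) xs y"
inductive_cases evaluates_PrimRec_0E: "evaluates (PrimRec p q) (0 # xs) y"
inductive_cases evaluates_PrimRec_SucE: "evaluates (PrimRec p q) (Suc n # xs) y"
inductive_cases evaluates_MuE: "evaluates (Mu p) xs y"

lemma evaluates_functional:
  "evaluates p xs y \<Longrightarrow> evaluates p xs z \<Longrightarrow> y = z"
proof (induction arbitrary: z rule: evaluates.induct)
  case (zero xs)
  then show ?case by (rule evaluates_ZeroE) simp
next
  case (succ x)
  then show ?case by (rule evaluates_SuccE) simp
next
  case (proj i xs)
  from proj.prems show ?case by (rule evaluates_ProjE) simp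
next
  case (comp xs qs ys p w)
  from comp.prems obtain ys' where ys': "list_all2 (\<lambda>q. evaluates q xs) qs ys'"
    and z: "evaluates p ys' z"
    by (elim evaluates_CompE)
  have "ys = ys'"
  proof (intro nth_equalityI)
    show "length ys = length ys'"
      using comp.IH(1) ys' by (simp add: list_all2_conv_all_nth)
    show "ys ! i = ys' ! i" if "i < length ys" for i
      using comp.IH(1) ys' that by (simp add: list_all2_conv_all_nth)
  qed
  then show ?case
    using comp.IH(2) z by simp
next
  case (primrec_0 p xs y q)
  from primrec_0.prems show ?case
    by (rule evaluates_PrimRec_0E) (rule primrec_0.IH)
next
  case (primrec_Suc p q n xs r y)
  from primrec_Suc.prems obtain r' where r': "evaluates (PrimRec p q) (n # xs) r'"
    and z: "evaluates q (n # r' # xs) z"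
    by (rule evaluates_PrimRec_SucE)
  have "r = r'"
    using r' by (rule primrec_Suc.IH(1))
  with z show ?case
    by (intro primrec_Suc.IH(2)) simp
next
  case (mu p n xs)
  from mu.prems have z: "evaluates p (z # xs) 0" "\<forall>m<z. \<exists>y. evaluates p (m # xs) (Suc y)"
    by (blast elim: evaluates_MuE)+
  show ?case
  proof (cases n z rule: linorder_cases)
    case less
    then show ?thesis using z(2) mu.IH(1) by (metis nat.distinct(1))
  next
    case greater
    then show ?thesis using z(1) mu.IH(2) by (metis nat.distinct(1))
  qed
qed

text \<open>
  The natural numbers of the development start at 1. A function on a set \<open>D\<close> is represented by a
  total HOL function whose values outside \<open>D\<close> are irrelevant; it is computable if it is, as a
  partial function with domain exactly \<open>D\<close>, partial recursive.
\<close>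

abbreviation PosNat :: "nat set" where
  "PosNat \<equiv> {1..}"

definition computable_on :: "nat set \<Rightarrow> (nat \<Rightarrow> nat) \<Rightarrow> bool" where
  "computable_on D f \<longleftrightarrow> (\<exists>p. \<forall>x y. evaluates p [x] y \<longleftrightarrow> x \<in> D \<and> y = f x)"

definition re_set :: "nat set \<Rightarrow> bool" where
  "re_set A \<longleftrightarrow> A \<subseteq> PosNat \<and> (\<exists>p. A = {x. \<exists>y. evaluates p [x] y})"

section \<open>One-one reducibility\<close>

definition one_reducible :: "nat set \<Rightarrow> nat set \<Rightarrow> bool" (infix "\<le>\<^sub>1" 50) where
  "A \<le>\<^sub>1 B \<longleftrightarrow> (\<exists>f. f ` PosNat \<subseteq> PosNat \<and> inj_on f PosNat \<and> computable_on PosNat f \<and>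
      (\<forall>x\<in>PosNat. x \<in> A \<longleftrightarrow> f x \<in> B))"

definition one_equivalent :: "nat set \<Rightarrow> nat set \<Rightarrow> bool" (infix "\<equiv>\<^sub>1" 50) where
  "A \<equiv>\<^sub>1 B \<longleftrightarrow> A \<le>\<^sub>1 B \<and> B \<le>\<^sub>1 A"

section \<open>Listings and uniformity\<close>

definition listing_domain :: "nat set \<Rightarrow> nat set" where
  "listing_domain A = (if finite A then {1..card A} else PosNat)"

definition is_listing :: "nat set \<Rightarrow> (nat \<Rightarrow> nat) \<Rightarrow> bool" where
  "is_listing A h \<longleftrightarrow> bij_betw h (listing_domain A) A \<and> computable_on (listing_domain A) h"

definition uniform_listings :: "nat set \<Rightarrow> (nat \<Rightarrow> nat) \<Rightarrow> (nat \<Rightarrow> nat) \<Rightarrow> bool" where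
  "uniform_listings D h g \<longleftrightarrow> (\<forall>i\<in>D. \<forall>j\<in>D. h i < h j \<longleftrightarrow> g i < g j)"

text \<open>
  Equipollent sets of natural numbers have the same listing domain, so in the following definition
  \<open>listing_domain A\<close> is also the domain of the listings of \<open>B\<close>.
\<close>

definition uniform :: "nat set \<Rightarrow> nat set \<Rightarrow> bool" (infix "\<sim>" 50) where
  "A \<sim> B \<longleftrightarrow> re_set A \<and> re_set B \<and> A \<approx> B \<and>
      (\<exists>h g. is_listing A h \<and> is_listing B g \<and> uniform_listings (listing_domain A) h g)"

end

theory Submission
  imports Defs "HOL-Library.Nat_Bijection"
begin

text \<open>
  The order isomorphism between two infinite sets of naturals is unique, so \<open>A \<sim> B\<close> forces it to be
  computable. Let \<open>K\<close> be the halting set, and let \<open>A\<close> consist of all \<open>2n+2\<close> together with the \<open>2n+3\<close>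
  for \<open>n \<in> K\<close>; let \<open>B\<close> be obtained from \<open>A\<close> by interchanging \<open>2n+2\<close> and \<open>2n+3\<close> for every \<open>n\<close>. This
  interchange is a computable permutation, so \<open>A \<equiv>\<^sub>1 B\<close>, but the order isomorphism from \<open>A\<close> to \<open>B\<close>
  maps \<open>2n+2\<close> to \<open>2n+2\<close> if \<open>n \<in> K\<close> and to \<open>2n+3\<close> otherwise, so it would decide \<open>K\<close>.

  The halting set is recursively enumerable because an evaluation is witnessed by a finite set of
  facts each of which follows by one rule from others in the set, which is decidable. No order on
  the facts is needed: every rule leads back to a smaller term or a smaller recursion argument, so
  justification cannot be circular.
\<close>

section \<open>Total computable functions and decidable predicates\<close>

text \<open>One implication is enough, since values are unique by
  \<open>evaluates_functional\<close>. Values on lists of other lengths are left open.\<close>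

definition computable :: "(nat \<Rightarrow> nat) \<Rightarrow> bool" where
  "computable f \<longleftrightarrow> (\<exists>p. \<forall>x. evaluates p [x] (f x))"

definition decidable :: "(nat \<Rightarrow> bool) \<Rightarrow> bool" where
  "decidable P \<longleftrightarrow> computable (\<lambda>x. of_bool (P x))"

text \<open>With these projections a binary predicate \<open>R\<close> becomes the unary one
  \<open>R (pfst y) (psnd y)\<close>, so a single notion of decidability, for one argument, suffices
  throughout.\<close>

definition pfst :: "nat \<Rightarrow> nat" where
  "pfst n = fst (prod_decode n)"

definition psnd :: "nat \<Rightarrow> nat" where
  "psnd n = snd (prod_decode n)"

lemma pfst_prod_encode [simp]: "pfst (prod_encode (a, b)) = a"
  by (simp add: pfst_def)

lemma psnd_prod_encode [simp]: "psnd (prod_encode (a, b)) = b"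
  by (simp add: psnd_def)

lemma prod_encode_pfst_psnd [simp]: "prod_encode (pfst n, psnd n) = n"
  by (simp add: pfst_def psnd_def)

lemma evaluates_ProjI: "i < length xs \<Longrightarrow> y = xs ! i \<Longrightarrow> evaluates (Proj i) xs y"
  by (simp add: evaluates.proj)

lemma evaluates_Comp1: "evaluates q xs y \<Longrightarrow> evaluates p [y] z \<Longrightarrow> evaluates (Comp p [q]) xs z"
  by (rule evaluates.comp[of _ _ "[y]"]) auto

lemma evaluates_Comp2:
  "evaluates q xs y \<Longrightarrow> evaluates q' xs y' \<Longrightarrow> evaluates p [y, y'] z \<Longrightarrow>
    evaluates (Comp p [q, q']) xs z"
  by (rule evaluates.comp[of _ _ "[y, y']"]) auto

named_theorems computable_intros

lemma computable_id [computable_intros]: "computable (\<lambda>x. x)"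
  unfolding computable_def by (rule exI[of _ "Proj 0"]) (simp add: evaluates_ProjI)

lemma computable_Suc [computable_intros]: "computable f \<Longrightarrow> computable (\<lambda>x. Suc (f x))"
  unfolding computable_def by (meson evaluates.succ evaluates_Comp1)

lemma computable_const [computable_intros]: "computable (\<lambda>x. c)"
proof (induction c)
  case 0
  then show ?case unfolding computable_def using evaluates.zero by blast
next
  case (Suc c)
  then show ?case by (rule computable_Suc)
qed

lemma computable_comp2:
  assumes "\<And>x y. evaluates p [x, y] (F x y)" "computable f" "computable g"
  shows "computable (\<lambda>x. F (f x) (g x))"
  using assms unfolding computable_def by (meson evaluates_Comp2)

lemma computable_comp: "computable F \<Longrightarrow> computable f \<Longrightarrow> computable (\<lambda>x. F (f x))"
  unfolding computable_def by (meson evaluates_Comp1)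

section \<open>Arithmetic and pairing by primitive recursion\<close>

definition r_add :: recf where
  "r_add = PrimRec (Proj 0) (Comp Succ [Proj 1])"

lemma evaluates_add: "evaluates r_add [x, y] (x + y)"
proof (induction x)
  case 0
  show ?case unfolding r_add_def by (rule evaluates.primrec_0) (simp add: evaluates_ProjI)
next
  case (Suc x)
  show ?case unfolding r_add_def
    by (rule evaluates.primrec_Suc[OF Suc.IH[unfolded r_add_def]])
      (rule evaluates_Comp1[of _ _ "x + y"], auto intro: evaluates_ProjI evaluates.succ)
qed

lemmas computable_add [computable_intros] = computable_comp2[OF evaluates_add]

definition r_mult :: recf where
  "r_mult = PrimRec Zero (Comp r_add [Proj 2, Proj 1])"

lemma evaluates_mult: "evaluates r_mult [x, y] (x * y)"
proof (induction x)
  case 0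
  show ?case unfolding r_mult_def by (rule evaluates.primrec_0) (simp add: evaluates.zero)
next
  case (Suc x)
  show ?case unfolding r_mult_def
    by (rule evaluates.primrec_Suc[OF Suc.IH[unfolded r_mult_def]])
      (rule evaluates_Comp2[of _ _ y _ "x * y"],
        auto intro: evaluates_ProjI evaluates_add)
qed

lemmas computable_mult [computable_intros] = computable_comp2[OF evaluates_mult]

definition r_pred :: recf where
  "r_pred = PrimRec Zero (Proj 0)"

lemma evaluates_pred: "evaluates r_pred [x] (x - 1)"
proof (induction x)
  case 0
  show ?case unfolding r_pred_def by (rule evaluates.primrec_0) (simp add: evaluates.zero)
next
  case (Suc x)
  show ?case unfolding r_pred_def
    by (rule evaluates.primrec_Suc[OF Suc.IH[unfolded r_pred_def]]) (simp add: evaluates_ProjI)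
qed

text \<open>The subtrahend comes first because the recursion variable is the first argument.\<close>

definition r_sub :: recf where
  "r_sub = PrimRec (Proj 0) (Comp r_pred [Proj 1])"

lemma evaluates_sub: "evaluates r_sub [y, x] (x - y)"
proof (induction y)
  case 0
  show ?case unfolding r_sub_def by (rule evaluates.primrec_0) (simp add: evaluates_ProjI)
next
  case (Suc y)
  have "evaluates r_pred [x - y] (x - Suc y)"
    using evaluates_pred[of "x - y"] by simp
  then show ?case unfolding r_sub_def
    by (intro evaluates.primrec_Suc[OF Suc.IH[unfolded r_sub_def]])
      (rule evaluates_Comp1[of _ _ "x - y"], auto intro: evaluates_ProjI)
qed

lemma computable_sub [computable_intros]:
  "computable f \<Longrightarrow> computable g \<Longrightarrow> computable (\<lambda>x. f x - g x)"
  using computable_comp2[OF evaluates_sub, of g f] by simp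

lemma computable_power [computable_intros]:
  assumes "computable f"
  shows "computable (\<lambda>x. c ^ f x)"
proof -
  obtain m where m: "evaluates m [x] (c * x)" for x
    using computable_mult[OF computable_const computable_id, of c] by (auto simp: computable_def)
  obtain z where z: "evaluates z [x] 1" for x
    using computable_const[of 1] by (auto simp: computable_def)
  let ?p = "PrimRec (Comp Succ [Zero]) (Comp m [Proj 1])"
  have "evaluates ?p [n] (c ^ n)" for n
  proof (induction n)
    case 0
    show ?case by (rule evaluates.primrec_0)
        (metis One_nat_def evaluates.succ evaluates.zero evaluates_Comp1 power_0)
  next
    case (Suc n)
    show ?case
      by (rule evaluates.primrec_Suc[OF Suc.IH], rule evaluates_Comp1[of _ _ "c ^ n"])
        (auto intro: evaluates_ProjI m)
  qed
  then have "computable (\<lambda>n. c ^ n)" unfolding computable_def by blast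
  from computable_comp[OF this assms] show ?thesis .
qed

lemma computable_triangle [computable_intros]:
  assumes "computable f"
  shows "computable (\<lambda>x. triangle (f x))"
proof -
  let ?p = "PrimRec Zero (Comp r_add [Proj 1, Comp Succ [Proj 0]])"
  have "evaluates ?p [n] (triangle n)" for n
  proof (induction n)
    case 0
    show ?case by (rule evaluates.primrec_0) (simp add: evaluates.zero)
  next
    case (Suc n)
    have "evaluates (Comp Succ [Proj 0]) [n, triangle n] (Suc n)"
      by (rule evaluates_Comp1[of _ _ n]) (auto intro: evaluates_ProjI evaluates.succ)
    moreover have "evaluates r_add [triangle n, Suc n] (triangle (Suc n))"
      using evaluates_add[of "triangle n" "Suc n"] by simp
    ultimately show ?case
      by (intro evaluates.primrec_Suc[OF Suc.IH] evaluates_Comp2[of _ _ "triangle n" _ "Suc n"])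
        (auto intro: evaluates_ProjI)
  qed
  then have "computable triangle" unfolding computable_def by blast
  from computable_comp[OF this assms] show ?thesis .
qed

text \<open>Cantor's formula \<open>triangle (x + y) + x\<close>. A term for \<open>triangle\<close>
  is chosen because its computability gives only existence, while pairing is needed as one fixed
  binary term.\<close>

definition r_pair :: recf where
  "r_pair = Comp r_add [Comp (SOME t. \<forall>x. evaluates t [x] (triangle x)) [r_add], Proj 0]"

lemma evaluates_pair: "evaluates r_pair [x, y] (prod_encode (x, y))"
proof -
  have "\<exists>t. \<forall>x. evaluates t [x] (triangle x)"
    using computable_triangle[OF computable_id] by (simp add: computable_def)
  from someI_ex[OF this]
  have "evaluates (SOME t. \<forall>x. evaluates t [x] (triangle x)) [x + y] (triangle (x + y))"
    by blast
  then show ?thesis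
    unfolding r_pair_def prod_encode_def
    by (intro evaluates_Comp2[of _ _ "triangle (x + y)" _ x] evaluates_Comp1[of _ _ "x + y"])
      (auto intro: evaluates_ProjI evaluates_add)
qed

lemmas computable_pair [computable_intros] = computable_comp2[OF evaluates_pair]

section \<open>Minimisation and the inverse of pairing\<close>

lemma evaluates_Mu_LeastI:
  assumes "\<And>n. evaluates p (n # xs) (f n)" "\<exists>n. f n = 0"
  shows "evaluates (Mu p) xs (LEAST n. f n = 0)"
proof (rule evaluates.mu)
  show "evaluates p ((LEAST n. f n = 0) # xs) 0"
    using assms LeastI_ex[OF assms(2)] by metis
  show "\<forall>m<LEAST n. f n = 0. \<exists>y. evaluates p (m # xs) (Suc y)"
    using assms(1) not_less_Least by (metis not0_implies_Suc)
qed

text \<open>The code of \<open>(a, b)\<close> lies on diagonal \<open>a + b\<close>, the least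
  \<open>w\<close> with \<open>n < triangle (Suc w)\<close>. Truncated subtraction writes this
  inequality as an equation with zero, the form that minimisation tests.\<close>

lemma prod_decode_Least:
  defines "w \<equiv> \<lambda>n. LEAST w. Suc n - triangle (Suc w) = 0"
  shows "pfst n = n - triangle (w n)" "psnd n = w n - pfst n"
proof -
  obtain a b where ab: "n = prod_encode (a, b)"
    by (metis prod_encode_pfst_psnd)
  have mono: "triangle i \<le> triangle j" if "i \<le> j" for i j
    using that by (induction rule: dec_induct) auto
  have "w n = a + b"
    unfolding w_def
  proof (rule Least_equality)
    show "Suc n - triangle (Suc (a + b)) = 0"
      by (simp add: ab prod_encode_def)
    show "a + b \<le> v" if "Suc n - triangle (Suc v) = 0" for v
      using that mono[of "Suc v" "a + b"] by (force simp: ab prod_encode_def not_less_eq_eq)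
  qed
  then show "pfst n = n - triangle (w n)" "psnd n = w n - pfst n"
    by (simp_all add: ab) (simp add: prod_encode_def)
qed

lemma computable_pfst [computable_intros]: "computable f \<Longrightarrow> computable (\<lambda>x. pfst (f x))"
  and computable_psnd [computable_intros]: "computable f \<Longrightarrow> computable (\<lambda>x. psnd (f x))"
proof -
  obtain t where t: "evaluates t [x] (triangle (Suc x))" for x
    using computable_triangle[OF computable_Suc[OF computable_id]]
    by (auto simp: computable_def)
  let ?p = "Comp r_sub [Comp t [Proj 0], Comp Succ [Proj 1]]"
  have "evaluates ?p [w, n] (Suc n - triangle (Suc w))" for w n
    by (rule evaluates_Comp2[OF evaluates_Comp1[OF _ t[of w]]
          evaluates_Comp1[OF _ evaluates.succ[of n]] evaluates_sub])
      (simp_all add: evaluates_ProjI)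
  then have "evaluates (Mu ?p) [n] (LEAST w. Suc n - triangle (Suc w) = 0)" for n
  proof (rule evaluates_Mu_LeastI)
    show "\<exists>w. Suc n - triangle (Suc w) = 0"
      by (rule exI[of _ n]) simp
  qed
  then have c: "computable (\<lambda>n. LEAST w. Suc n - triangle (Suc w) = 0)"
    unfolding computable_def by blast
  have 1: "computable pfst"
    unfolding prod_decode_Least(1) by (intro computable_intros c)
  moreover have "computable psnd"
    unfolding prod_decode_Least(2)[abs_def] by (intro computable_intros c 1)
  ultimately show "computable f \<Longrightarrow> computable (\<lambda>x. pfst (f x))"
    and "computable f \<Longrightarrow> computable (\<lambda>x. psnd (f x))"
    using computable_comp by blast+
qed

section \<open>Boolean combinations of decidable predicates\<close>

lemma decidable_less [computable_intros]:
  assumes "computable f" "computable g"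
  shows "decidable (\<lambda>x. f x < g x)"
proof -
  \<comment> \<open>The inner truncated difference vanishes exactly when
    \<open>f x < g x\<close>.\<close>
  have "(\<lambda>x. of_bool (f x < g x)) = (\<lambda>x. 1 - (Suc (f x) - g x))"
    by auto
  then show ?thesis
    unfolding decidable_def by (simp only:) (intro computable_intros assms)
qed

lemma decidable_not [computable_intros]:
  assumes "decidable P"
  shows "decidable (\<lambda>x. \<not> P x)"
proof -
  have "(\<lambda>x. of_bool (\<not> P x)) = (\<lambda>x. 1 - of_bool (P x) :: nat)"
    by auto
  then show ?thesis
    using assms unfolding decidable_def by (simp only:) (intro computable_intros)
qed

lemma decidable_conj [computable_intros]:
  assumes "decidable P" "decidable Q"
  shows "decidable (\<lambda>x. P x \<and> Q x)"
proof -
  have "(\<lambda>x. of_bool (P x \<and> Q x)) = (\<lambda>x. of_bool (P x) * of_bool (Q x) :: nat)"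
    by auto
  then show ?thesis
    using assms unfolding decidable_def by (simp only:) (intro computable_intros)
qed

lemma decidable_disj [computable_intros]:
  assumes "decidable P" "decidable Q"
  shows "decidable (\<lambda>x. P x \<or> Q x)"
proof -
  have "decidable (\<lambda>x. \<not> (\<not> P x \<and> \<not> Q x))"
    by (intro computable_intros assms)
  then show ?thesis by simp
qed

lemma decidable_imp [computable_intros]:
  "decidable P \<Longrightarrow> decidable Q \<Longrightarrow> decidable (\<lambda>x. P x \<longrightarrow> Q x)"
  unfolding imp_conv_disj by (intro computable_intros)

lemma decidable_if [computable_intros]:
  assumes "decidable P" "decidable Q" "decidable R"
  shows "decidable (\<lambda>x. if P x then Q x else R x)"
  unfolding if_bool_eq_conj by (intro computable_intros assms)

lemma decidable_eq [computable_intros]: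
  assumes "computable f" "computable g"
  shows "decidable (\<lambda>x. f x = g x)"
  \<comment> \<open>Equality is rewritten as the failure of both strict inequalities.\<close>
  unfolding nat_neq_iff[THEN arg_cong[where f = Not], simplified not_not]
  by (intro computable_intros assms)

section \<open>Unbounded search, bounded quantifiers and semidecidable domains\<close>

text \<open>Minimisation looks for a zero, so the term tests the negation of \<open>R\<close>. As
  this test is total, the search diverges exactly when there is no witness.\<close>

lemma decidable_Mu:
  assumes "decidable (\<lambda>y. R (pfst y) (psnd y))"
  shows "\<exists>p. \<forall>x n. evaluates p [x] n \<longleftrightarrow> R n x \<and> (\<forall>m<n. \<not> R m x)"
proof -
  obtain q where q: "evaluates q [y] (of_bool (\<not> R (pfst y) (psnd y)))" for y
    using decidable_not[OF assms] unfolding decidable_def computable_def by blast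
  define q' where "q' = Comp q [r_pair]"
  have q': "evaluates q' [n, x] (of_bool (\<not> R n x))" for n x
    unfolding q'_def
    using q[of "prod_encode (n, x)"]
    by (intro evaluates_Comp1[OF evaluates_pair]) simp
  have "evaluates q' [n, x] y \<longleftrightarrow> y = of_bool (\<not> R n x)" for n x y
    using q'[of n x] evaluates_functional by blast
  then have "evaluates (Mu q') [x] n \<longleftrightarrow> R n x \<and> (\<forall>m<n. \<not> R m x)" for n x
    by (auto elim!: evaluates_MuE intro!: evaluates.mu split: if_splits)
  then show ?thesis by blast
qed

lemma computable_Least [computable_intros]:
  assumes "decidable (\<lambda>y. R (pfst y) (psnd y))" "\<And>x. \<exists>n. R n x"
  shows "computable (\<lambda>x. LEAST n. R n x)"
proof -
  obtain p where "evaluates p [x] n \<longleftrightarrow> R n x \<and> (\<forall>m<n. \<not> R m x)" for x n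
    using decidable_Mu[OF assms(1)] by blast
  then have "evaluates p [x] (LEAST n. R n x)" for x
    using LeastI_ex[OF assms(2)] not_less_Least by metis
  then show ?thesis unfolding computable_def by blast
qed

lemma decidable_bex [computable_intros]:
  assumes "computable b" "decidable (\<lambda>y. R (pfst y) (psnd y))"
  shows "decidable (\<lambda>x. \<exists>n<b x. R n x)"
proof -
  \<comment> \<open>The second disjunct stops the search at the bound, which makes it total; it ends
    below the bound exactly when a genuine witness was found.\<close>
  define l where "l = (\<lambda>x. LEAST n. R n x \<or> \<not> n < b x)"
  have "computable l"
    unfolding l_def
    by (intro computable_intros assms computable_comp[OF assms(1)]) blast
  moreover have "(\<exists>n<b x. R n x) \<longleftrightarrow> l x < b x" for x
  proof
    assume "\<exists>n<b x. R n x"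
    then obtain n where "n < b x" "R n x" by blast
    then show "l x < b x"
      unfolding l_def using Least_le[of "\<lambda>n. R n x \<or> \<not> n < b x" n] by simp
  next
    assume "l x < b x"
    moreover have "R (l x) x \<or> \<not> l x < b x"
      unfolding l_def by (rule LeastI[of _ "b x"]) simp
    ultimately show "\<exists>n<b x. R n x" by blast
  qed
  ultimately show ?thesis
    by (simp only:) (intro computable_intros assms)
qed

lemma decidable_ball [computable_intros]:
  assumes "computable b" "decidable (\<lambda>y. R (pfst y) (psnd y))"
  shows "decidable (\<lambda>x. \<forall>n<b x. R n x)"
proof -
  have "decidable (\<lambda>x. \<not> (\<exists>n<b x. \<not> R n x))"
    by (intro computable_intros assms)
  then show ?thesis by simp
qed

lemma computable_div [computable_intros]:
  assumes "computable f" "computable g"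
  shows "computable (\<lambda>x. f x div g x)"
proof -
  \<comment> \<open>The disjunct \<open>b = 0\<close> keeps the search total and returns 0, in
    agreement with \<open>a div 0 = 0\<close>.\<close>
  have eq: "a div b = (LEAST q. b = 0 \<or> a < Suc q * b)" for a b :: nat
  proof (cases "b = 0")
    case False
    then have "b = 0 \<or> a < Suc q * b \<longleftrightarrow> a div b \<le> q" for q
      by (metis div_less_iff_less_mult less_Suc_eq_le neq0_conv)
    then show ?thesis
      by (simp only:) (rule Least_equality[symmetric], auto)
  qed simp
  have "computable (\<lambda>x. LEAST q. g x = 0 \<or> f x < Suc q * g x)"
  proof (intro computable_intros computable_comp[OF assms(1)] computable_comp[OF assms(2)])
    show "\<exists>q. g x = 0 \<or> f x < Suc q * g x" for x
      by (rule exI[of _ "f x"]) (cases "g x", auto)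
  qed
  then show ?thesis by (simp add: eq)
qed

lemma decidable_even [computable_intros]:
  assumes "computable f"
  shows "decidable (\<lambda>x. even (f x))"
proof -
  have "even n \<longleftrightarrow> n = 2 * (n div 2)" for n :: nat
    by presburger
  then show ?thesis
    by (simp only:) (intro computable_intros assms)
qed

text \<open>Finite sets are coded by their binary digits, so membership is the parity of a quotient
  by a power of 2.\<close>

lemma decidable_set_decode [computable_intros]:
  assumes "computable f" "computable g"
  shows "decidable (\<lambda>x. f x \<in> set_decode (g x))"
  unfolding set_decode_def mem_Collect_eq by (intro computable_intros assms)

text \<open>The term \<open>Comp (Proj 0) [q, p]\<close> returns the value of \<open>q\<close> but
  also has to evaluate the search \<open>p\<close>, whose divergence cuts the domain down to the
  required set.\<close>

lemma computable_on_semidecidable: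
  assumes "computable f" "decidable (\<lambda>y. R (pfst y) (psnd y))"
  shows "computable_on {x. \<exists>n. R n x} f"
proof -
  obtain p where p: "evaluates p [x] n \<longleftrightarrow> R n x \<and> (\<forall>m<n. \<not> R m x)" for x n
    using decidable_Mu[OF assms(2)] by blast
  obtain q where "evaluates q [x] (f x)" for x
    using assms(1) unfolding computable_def by blast
  then have q: "evaluates q [x] y \<longleftrightarrow> y = f x" for x y
    using evaluates_functional by blast
  have "(\<exists>n. R n x) \<longleftrightarrow> (\<exists>n. evaluates p [x] n)" for x
    unfolding p by (rule exists_least_iff)
  moreover have "evaluates (Comp (Proj 0) [q, p]) [x] y \<longleftrightarrow> (\<exists>n. evaluates p [x] n) \<and> y = f x" for x y
  proof
    assume "evaluates (Comp (Proj 0) [q, p]) [x] y"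
    then show "(\<exists>n. evaluates p [x] n) \<and> y = f x"
      by (auto simp: q list_all2_Cons1 elim!: evaluates_CompE evaluates_ProjE)
  next
    assume "(\<exists>n. evaluates p [x] n) \<and> y = f x"
    then obtain n where "evaluates p [x] n" "evaluates q [x] y"
      using q by blast
    then show "evaluates (Comp (Proj 0) [q, p]) [x] y"
      by (auto intro!: evaluates_Comp2 evaluates_ProjI)
  qed
  ultimately show ?thesis
    unfolding computable_on_def by (intro exI[of _ "Comp (Proj 0) [q, p]"]) simp
qed

lemma domain_semidecidable:
  assumes "decidable (\<lambda>y. R (pfst y) (psnd y))"
  shows "\<exists>p. {x. \<exists>n. R n x} = {x. \<exists>y. evaluates p [x] y}"
  using computable_on_semidecidable[OF computable_id assms] unfolding computable_on_def by blast

section \<open>The halting set\<close>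

text \<open>The tag in the first component lets \<open>justified_with\<close> read off by
  projections which evaluation rule applies.\<close>

fun recf_encode :: "recf \<Rightarrow> nat" where
  "recf_encode Zero = prod_encode (0, 0)"
| "recf_encode Succ = prod_encode (1, 0)"
| "recf_encode (Proj i) = prod_encode (2, i)"
| "recf_encode (Comp p qs) =
    prod_encode (3, prod_encode (recf_encode p, list_encode (map recf_encode qs)))"
| "recf_encode (PrimRec p q) = prod_encode (4, prod_encode (recf_encode p, recf_encode q))"
| "recf_encode (Mu p) = prod_encode (5, recf_encode p)"

text \<open>
  A fact \<open>fact_code t xs y\<close> states that the term with code \<open>t\<close> has value \<open>y\<close> on the list with code
  \<open>xs\<close>. Two further tags occur only in auxiliary facts: with tag 6, \<open>t\<close> contains a list of terms and
  \<open>y\<close> is the list of their values; with tag 7, on a list \<open>n # xs\<close>, the value \<open>y\<close> is a dummy and the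
  term has a nonzero value on \<open>m # xs\<close> for all \<open>m < n\<close>.
\<close>

abbreviation fact_code :: "nat \<Rightarrow> nat \<Rightarrow> nat \<Rightarrow> nat" where
  "fact_code t xs y \<equiv> prod_encode (t, prod_encode (xs, y))"

text \<open>This is how \<open>list_encode\<close> codes a nonempty list; \<open>Suc\<close> keeps
  the code apart from 0, the code of the empty list.\<close>

abbreviation cons_code :: "nat \<Rightarrow> nat \<Rightarrow> nat" where
  "cons_code x xs \<equiv> Suc (prod_encode (x, xs))"

text \<open>
  Below, \<open>k\<close> and \<open>c\<close> are the tag and the content of the term code, and \<open>x\<close> and \<open>l\<close> are the head and
  the tail of the list \<open>xs\<close>; they are meaningless for the empty list, whose code is 0.
\<close>

definition justified_with :: "nat set \<Rightarrow> nat \<Rightarrow> nat \<Rightarrow> nat \<Rightarrow> nat \<Rightarrow> nat \<Rightarrow> nat \<Rightarrow> bool" where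
  "justified_with S k c xs y x l \<longleftrightarrow>
      k = 0 \<and> y = 0
    \<or> k = 1 \<and> xs \<noteq> 0 \<and> l = 0 \<and> y = Suc x
    \<or> k = 2 \<and> xs \<noteq> 0 \<and> (if c = 0 then y = x else fact_code (prod_encode (2, c - 1)) l y \<in> S)
    \<or> k = 3 \<and> (\<exists>ys. fact_code (prod_encode (6, psnd c)) xs ys \<in> S \<and> fact_code (pfst c) ys y \<in> S)
    \<or> k = 4 \<and> xs \<noteq> 0 \<and>
        (if x = 0 then fact_code (pfst c) l y \<in> S
         else \<exists>r. fact_code (prod_encode (k, c)) (cons_code (x - 1) l) r \<in> S \<and>
                  fact_code (psnd c) (cons_code (x - 1) (cons_code r l)) y \<in> S)
    \<or> k = 5 \<and> fact_code c (cons_code y xs) 0 \<in> S \<and>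
        fact_code (prod_encode (7, c)) (cons_code y xs) 0 \<in> S
    \<or> k = 6 \<and>
        (if c = 0 then y = 0
         else y \<noteq> 0 \<and> fact_code (pfst (c - 1)) xs (pfst (y - 1)) \<in> S \<and>
              fact_code (prod_encode (6, psnd (c - 1))) xs (psnd (y - 1)) \<in> S)
    \<or> k = 7 \<and> xs \<noteq> 0 \<and>
        (x \<noteq> 0 \<longrightarrow> fact_code (prod_encode (7, c)) (cons_code (x - 1) l) 0 \<in> S \<and>
                  (\<exists>z. fact_code c (cons_code (x - 1) l) (Suc z) \<in> S))"

text \<open>Subtracting 1 undoes the \<open>Suc\<close> of a nonempty list code before head and tail
  are projected.\<close>

definition justified :: "nat set \<Rightarrow> nat \<Rightarrow> bool" where
  "justified S f \<longleftrightarrow> justified_with S (pfst (pfst f)) (psnd (pfst f)) (pfst (psnd f)) (psnd (psnd f))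
    (pfst (pfst (psnd f) - 1)) (psnd (pfst (psnd f) - 1))"

definition certificate :: "nat set \<Rightarrow> bool" where
  "certificate S \<longleftrightarrow> (\<forall>f\<in>S. justified S f)"

section \<open>Certificates: soundness\<close>

text \<open>The set occurs only positively: a rule asks for the presence of facts, never for their
  absence. Hence certificates can be united.\<close>

lemma justified_mono:
  assumes "justified S f" "S \<subseteq> T"
  shows "justified T f"
proof -
  have mono: "\<And>x. x \<in> S \<Longrightarrow> x \<in> T" using assms(2) by blast
  show ?thesis
    using assms(1) unfolding justified_def justified_with_def
    by (elim disj_forward conj_forward ex_forward imp_forward mono; (auto split: if_splits dest: mono)?)
qed

lemma certificate_justified_with:
  assumes "certificate S" "fact_code (prod_encode (k, c)) xs y \<in> S"
  shows "justified_with S k c xs y (pfst (xs - 1)) (psnd (xs - 1))"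
  using assms by (fastforce simp: certificate_def justified_def)

text \<open>Structural induction on the term handles premises about smaller terms. The remaining
  premises, about projections, primitive recursion and the auxiliary tags, have a smaller index,
  recursion argument or list of terms, and an inner induction handles them.\<close>

lemma certificate_sound:
  assumes cert: "certificate S"
  shows "fact_code (recf_encode p) (list_encode xs) y \<in> S \<Longrightarrow> evaluates p xs y"
proof (induction p arbitrary: xs y)
  case Zero
  then show ?case
    using certificate_justified_with[OF cert, of 0 0]
    by (auto simp: justified_with_def intro: evaluates.zero)
next
  case Succ
  then have "justified_with S 1 0 (list_encode xs) y (pfst (list_encode xs - 1))
      (psnd (list_encode xs - 1))"
    by (intro certificate_justified_with[OF cert]) simp
  then show ?case
    by (cases xs; cases "tl xs") (auto simp: justified_with_def intro: evaluates.succ)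
next
  case (Proj i)
  then show ?case
  proof (induction i arbitrary: xs)
    case 0
    then have "justified_with S 2 0 (list_encode xs) y (pfst (list_encode xs - 1))
        (psnd (list_encode xs - 1))"
      by (intro certificate_justified_with[OF cert]) simp
    then show ?case
      by (cases xs) (auto simp: justified_with_def intro: evaluates_ProjI)
  next
    case (Suc i)
    then have "justified_with S 2 (Suc i) (list_encode xs) y (pfst (list_encode xs - 1))
        (psnd (list_encode xs - 1))"
      by (intro certificate_justified_with[OF cert]) simp
    then obtain x l where "xs = x # l"
      "fact_code (recf_encode (Proj i)) (list_encode l) y \<in> S"
      by (cases xs) (auto simp: justified_with_def)
    with Suc.IH[of l] show ?case
      by (auto elim!: evaluates_ProjE intro: evaluates_ProjI)
  qed
next
  case (Comp p qs)
  \<comment> \<open>The certificate only supplies a number \<open>v\<close>; the list of values it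
    codes is rebuilt along the list of terms.\<close>
  have list: "\<exists>ys. v = list_encode ys \<and> list_all2 (\<lambda>q. evaluates q xs) rs ys"
    if "fact_code (prod_encode (6, list_encode (map recf_encode rs))) (list_encode xs) v \<in> S"
      "set rs \<subseteq> set qs" for rs v
    using that
  proof (induction rs arbitrary: v)
    case Nil
    then show ?case
      using certificate_justified_with[OF cert Nil(1)]
      by (auto simp: justified_with_def intro: exI[of _ "[]"])
  next
    case (Cons r rs)
    from certificate_justified_with[OF cert Cons.prems(1)]
    have v: "v \<noteq> 0"
      and r: "fact_code (recf_encode r) (list_encode xs) (pfst (v - 1)) \<in> S"
      and rs: "fact_code (prod_encode (6, list_encode (map recf_encode rs))) (list_encode xs)
        (psnd (v - 1)) \<in> S"
      by (auto simp: justified_with_def)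
    from Cons.IH[OF rs] Cons.prems(2) obtain ys
      where ys: "psnd (v - 1) = list_encode ys" "list_all2 (\<lambda>q. evaluates q xs) rs ys"
      by auto
    have "v = list_encode (pfst (v - 1) # ys)"
      using v by (simp flip: ys(1))
    moreover have "evaluates r xs (pfst (v - 1))"
      using Comp.IH(2) r Cons.prems(2) by simp
    ultimately show ?case
      using ys(2) by (intro exI[of _ "pfst (v - 1) # ys"]) simp
  qed
  from certificate_justified_with[OF cert, of 3] Comp.prems obtain v
    where "fact_code (prod_encode (6, list_encode (map recf_encode qs))) (list_encode xs) v \<in> S"
      and "fact_code (recf_encode p) v y \<in> S"
    by (fastforce simp: justified_with_def)
  with list[of qs v] Comp.IH(1) show ?case
    by (auto intro: evaluates.comp)
next
  case (PrimRec p q)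
  have "justified_with S 4 (prod_encode (recf_encode p, recf_encode q)) (list_encode xs) y
      (pfst (list_encode xs - 1)) (psnd (list_encode xs - 1))"
    using PrimRec.prems by (intro certificate_justified_with[OF cert]) simp
  then obtain n l where xs: "xs = n # l"
    by (cases xs) (auto simp: justified_with_def)
  have "evaluates (PrimRec p q) (n # l) y"
    if "fact_code (recf_encode (PrimRec p q)) (list_encode (n # l)) y \<in> S" for n y
    using that
  proof (induction n arbitrary: y)
    case 0
    with certificate_justified_with[OF cert, of 4]
    have "fact_code (recf_encode p) (list_encode l) y \<in> S"
      by (fastforce simp: justified_with_def)
    then show ?case
      by (intro evaluates.primrec_0 PrimRec.IH(1))
  next
    case (Suc n)
    with certificate_justified_with[OF cert, of 4] obtain r
      where "fact_code (recf_encode (PrimRec p q)) (list_encode (n # l)) r \<in> S"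
        and "fact_code (recf_encode q) (list_encode (n # r # l)) y \<in> S"
      by (fastforce simp: justified_with_def)
    then show ?case
      by (intro evaluates.primrec_Suc[of _ _ _ _ r] Suc.IH PrimRec.IH(2))
  qed
  with PrimRec.prems show ?case
    by (simp add: xs)
next
  case (Mu p)
  from certificate_justified_with[OF cert, of 5] Mu.prems
  have 0: "fact_code (recf_encode p) (list_encode (y # xs)) 0 \<in> S"
    and below: "fact_code (prod_encode (7, recf_encode p)) (list_encode (y # xs)) 0 \<in> S"
    by (fastforce simp: justified_with_def)+
  \<comment> \<open>The facts with tag 7 descend from \<open>n\<close> to 0, each step yielding one
    more nonzero value.\<close>
  have "\<forall>m<n. \<exists>z. evaluates p (m # xs) (Suc z)"
    if "fact_code (prod_encode (7, recf_encode p)) (list_encode (n # xs)) 0 \<in> S" for n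
    using that
  proof (induction n)
    case (Suc n)
    from certificate_justified_with[OF cert Suc.prems] obtain z
      where "fact_code (prod_encode (7, recf_encode p)) (list_encode (n # xs)) 0 \<in> S"
        and "fact_code (recf_encode p) (list_encode (n # xs)) (Suc z) \<in> S"
      by (auto simp: justified_with_def)
    with Suc.IH Mu.IH[of "n # xs"] show ?case
      by (metis less_Suc_eq)
  qed simp
  with 0 below Mu.IH show ?case
    by (blast intro: evaluates.mu)
qed

section \<open>Certificates: completeness\<close>

definition certified :: "nat \<Rightarrow> bool" where
  "certified f \<longleftrightarrow> (\<exists>S. finite S \<and> certificate S \<and> f \<in> S)"

text \<open>The certificates of the finitely many premises are united and \<open>f\<close> is added;
  by monotonicity every fact stays justified.\<close>

lemma certifiedI:
  assumes "finite P" "\<And>g. g \<in> P \<Longrightarrow> certified g" "justified P f"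
  shows "certified f"
proof -
  from assms(2) obtain T where T: "\<And>g. g \<in> P \<Longrightarrow> finite (T g) \<and> certificate (T g) \<and> g \<in> T g"
    unfolding certified_def by metis
  let ?S = "insert f (\<Union>g\<in>P. T g)"
  have "certificate ?S"
    unfolding certificate_def
  proof
    fix h assume "h \<in> ?S"
    then consider "h = f" | g where "g \<in> P" "h \<in> T g" by blast
    then show "justified ?S h"
    proof cases
      case 1
      then show ?thesis using assms(3) T by (auto intro: justified_mono)
    next
      case 2
      then have "justified (T g) h" using T by (auto simp: certificate_def)
      then show ?thesis using 2 by (auto intro: justified_mono)
    qed
  qed
  moreover have "finite ?S" using assms(1) T by blast
  ultimately show ?thesis unfolding certified_def by blast
qed

text \<open>Rule induction on the evaluation. Composition and minimisation have a variable number of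
  premises; the facts with tags 6 and 7 break them into chains of steps with at most two premises
  each.\<close>

lemma evaluates_certified:
  "evaluates p xs y \<Longrightarrow> certified (fact_code (recf_encode p) (list_encode xs) y)"
proof (induction rule: evaluates.induct)
  case (zero xs)
  show ?case by (rule certifiedI[of "{}"]) (auto simp: justified_def justified_with_def)
next
  case (succ x)
  show ?case by (rule certifiedI[of "{}"]) (auto simp: justified_def justified_with_def)
next
  case (proj i xs)
  then show ?case
  proof (induction i arbitrary: xs)
    case 0
    then obtain x l where "xs = x # l" by (cases xs) auto
    then show ?case
      by - (rule certifiedI[of "{}"], auto simp: justified_def justified_with_def)
  next
    case (Suc i)
    then obtain x l where xs: "xs = x # l" "i < length l" by (cases xs) auto
    show ?case
      by (rule certifiedI[of "{fact_code (recf_encode (Proj i)) (list_encode l) (l ! i)}"])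
        (use Suc.IH xs in \<open>auto simp: justified_def justified_with_def\<close>)
  qed
next
  case (comp xs qs ys p z)
  from comp.IH(1)
  have "certified (fact_code (prod_encode (6, list_encode (map recf_encode qs))) (list_encode xs)
      (list_encode ys))"
  proof (induction rule: list_all2_induct)
    case Nil
    show ?case by (rule certifiedI[of "{}"]) (auto simp: justified_def justified_with_def)
  next
    case (Cons q qs y ys)
    show ?case
      by (rule certifiedI[of "{fact_code (recf_encode q) (list_encode xs) y,
            fact_code (prod_encode (6, list_encode (map recf_encode qs))) (list_encode xs)
              (list_encode ys)}"])
        (use Cons in \<open>auto simp: justified_def justified_with_def\<close>)
  qed
  with comp.IH(2) show ?case
    by - (rule certifiedI[of "{fact_code (prod_encode (6, list_encode (map recf_encode qs)))
            (list_encode xs) (list_encode ys),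
          fact_code (recf_encode p) (list_encode ys) z}"],
      auto simp: justified_def justified_with_def)
next
  case (primrec_0 p xs y q)
  then show ?case
    by - (rule certifiedI[of "{fact_code (recf_encode p) (list_encode xs) y}"],
      auto simp: justified_def justified_with_def)
next
  case (primrec_Suc p q n xs r y)
  then show ?case
    by - (rule certifiedI[of "{fact_code (recf_encode (PrimRec p q)) (list_encode (n # xs)) r,
          fact_code (recf_encode q) (list_encode (n # r # xs)) y}"],
      auto simp: justified_def justified_with_def)
next
  case (mu p n xs)
  then have "certified (fact_code (prod_encode (7, recf_encode p)) (list_encode (n # xs)) 0)"
  proof -
    have "m \<le> n \<Longrightarrow>
      certified (fact_code (prod_encode (7, recf_encode p)) (list_encode (m # xs)) 0)" for m
    proof (induction m)
      case 0
      show ?case by (rule certifiedI[of "{}"]) (auto simp: justified_def justified_with_def)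
    next
      case (Suc m)
      then obtain z where "certified (fact_code (recf_encode p) (list_encode (m # xs)) (Suc z))"
        using mu.IH(2) by (meson Suc_le_lessD)
      with Suc show ?case
        by - (rule certifiedI[of "{fact_code (prod_encode (7, recf_encode p)) (list_encode (m # xs)) 0,
              fact_code (recf_encode p) (list_encode (m # xs)) (Suc z)}"],
          auto simp: justified_def justified_with_def)
    qed
    then show ?thesis by simp
  qed
  with mu.IH(1) show ?case
    by - (rule certifiedI[of "{fact_code (prod_encode (7, recf_encode p)) (list_encode (n # xs)) 0,
          fact_code (recf_encode p) (list_encode (n # xs)) 0}"],
      auto simp: justified_def justified_with_def)
qed

section \<open>Self-application, diagonalisation and decidability of certificates\<close>

text \<open>The number \<open>s\<close> is the binary code of a candidate certificate, not a count
  of steps. As \<open>cons_code x 0\<close> codes the list \<open>[x]\<close>, the program is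
  applied to its own code.\<close>

definition halts_by :: "nat \<Rightarrow> nat \<Rightarrow> bool" where
  "halts_by s x \<longleftrightarrow> certificate (set_decode s) \<and>
    (\<exists>y. fact_code x (cons_code x 0) y \<in> set_decode s)"

lemma halts_by_recf_encode:
  "(\<exists>s. halts_by s (recf_encode p)) \<longleftrightarrow> (\<exists>y. evaluates p [recf_encode p] y)"
proof
  assume "\<exists>s. halts_by s (recf_encode p)"
  then show "\<exists>y. evaluates p [recf_encode p] y"
    using certificate_sound[of _ p "[recf_encode p]"] by (auto simp: halts_by_def)
next
  assume "\<exists>y. evaluates p [recf_encode p] y"
  then obtain y S where "finite S" "certificate S"
    "fact_code (recf_encode p) (list_encode [recf_encode p]) y \<in> S"
    using evaluates_certified unfolding certified_def by blast
  then show "\<exists>s. halts_by s (recf_encode p)"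
    by (intro exI[of _ "set_encode S"]) (auto simp: halts_by_def)
qed

text \<open>Diagonal argument: a term with this domain would halt on its own code exactly when it
  does not.\<close>

lemma halts_complement_not_domain:
  "{x. \<not> (\<exists>s. halts_by s x)} \<noteq> {x. \<exists>y. evaluates p [x] y}"
  using halts_by_recf_encode[of p] by blast

text \<open>A binary digit 1 at position \<open>x\<close> forces \<open>2 ^ x \<le> s\<close>. This
  bounds quantifiers over the elements of a coded set.\<close>

lemma less_of_mem_set_decode: "x \<in> set_decode s \<Longrightarrow> x < s"
proof -
  assume "x \<in> set_decode s"
  then have "s div 2 ^ x \<noteq> 0"
    unfolding set_decode_def by (intro notI) simp
  then have "2 ^ x \<le> s"
    by (simp add: div_eq_0_iff)
  with less_exp[of x] show "x < s" by linarith
qed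

text \<open>A witness is at most a component of a fact in the coded set, hence at most the fact,
  which is below \<open>s\<close>. The function \<open>g\<close> admits values of the shape
  \<open>Suc z\<close>, as in the rule for tag 7.\<close>

lemma ex_bounded_of_mem_set_decode:
  assumes "\<And>r. fact_code a b (g r) \<in> set_decode s \<Longrightarrow> r \<le> g r"
  shows "(\<exists>r. fact_code a b (g r) \<in> set_decode s \<and> P r) \<longleftrightarrow>
    (\<exists>r<s. fact_code a b (g r) \<in> set_decode s \<and> P r)"
proof -
  have "r < s" if "fact_code a b (g r) \<in> set_decode s" for r
    using less_of_mem_set_decode[OF that] assms[OF that] le_prod_encode_2[of "g r" b]
      le_prod_encode_2[of "prod_encode (b, g r)" a] by linarith
  then show ?thesis by blast
qed

lemmas ex_bounded_of_mem_set_decode_simps =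
  ex_bounded_of_mem_set_decode[where g = "\<lambda>r. r", simplified]
  ex_bounded_of_mem_set_decode[where g = Suc and P = "\<lambda>_. True", simplified]
  ex_bounded_of_mem_set_decode[where g = "\<lambda>r. r" and P = "\<lambda>_. True", simplified]

lemma decidable_justified:
  assumes "computable s" "computable f"
  shows "decidable (\<lambda>x. justified (set_decode (s x)) (f x))"
  unfolding justified_def justified_with_def ex_bounded_of_mem_set_decode_simps
  by (intro computable_intros assms computable_comp[OF assms(1)] computable_comp[OF assms(2)])

lemma decidable_halts_by:
  assumes "computable s" "computable f"
  shows "decidable (\<lambda>x. halts_by (s x) (f x))"
proof -
  have "certificate (set_decode n) \<longleftrightarrow> (\<forall>f<n. f \<in> set_decode n \<longrightarrow> justified (set_decode n) f)" for n
    unfolding certificate_def using less_of_mem_set_decode by blast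
  then show ?thesis
    unfolding halts_by_def ex_bounded_of_mem_set_decode_simps
    by (simp only:) (intro computable_intros decidable_justified assms
        computable_comp[OF assms(1)] computable_comp[OF assms(2)])
qed

section \<open>Sets with the same order type\<close>

text \<open>At the least disagreement \<open>a\<close>, the smaller of the two values must be taken
  by the other function at some \<open>c < a\<close>. There both functions agree, so the first takes
  the same value at \<open>c\<close> and at \<open>a\<close>.\<close>

lemma strict_mono_on_image_unique:
  fixes f g :: "nat \<Rightarrow> 'a::linorder"
  assumes f: "strict_mono_on A f" and g: "strict_mono_on A g" and "f ` A = g ` A" "a \<in> A"
  shows "f a = g a"
  using \<open>a \<in> A\<close>
proof (induction a rule: less_induct)
  case (less a)
  have *: "\<not> u a < v a"
    if u: "strict_mono_on A u" and v: "strict_mono_on A v" and eq: "u ` A = v ` A"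
      and IH: "\<And>c. c < a \<Longrightarrow> c \<in> A \<Longrightarrow> u c = v c" for u v :: "nat \<Rightarrow> 'a"
  proof
    assume "u a < v a"
    moreover obtain c where c: "c \<in> A" "u a = v c" using eq \<open>a \<in> A\<close> by blast
    ultimately have "c < a"
      using v less.prems by (metis linorder_neqE_nat order_less_asym strict_mono_onD order_less_irrefl)
    then have "u c = u a"
      using IH c by simp
    moreover have "u c < u a"
      using strict_mono_onD[OF u c(1) less.prems \<open>c < a\<close>] .
    ultimately show False by simp
  qed
  have "\<not> f a < g a"
    using f g assms(3) less.IH by (rule *)
  moreover have "\<not> g a < f a"
    using g f assms(3)[symmetric] less.IH[symmetric] by (rule *)
  ultimately show ?case by simp
qed

text \<open>The composition of \<open>g\<close> with the inverse of \<open>h\<close> preserves order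
  because the listings are uniform. The last conclusion keeps the link to the listings, through
  which values of \<phi> can be searched for.\<close>

lemma uniform_listings_strict_mono:
  assumes "uniform_listings D h g" "bij_betw h D A" "bij_betw g D B"
  obtains \<phi> where "strict_mono_on A \<phi>" "\<phi> ` A = B" "\<And>i. i \<in> D \<Longrightarrow> \<phi> (h i) = g i"
proof
  let ?\<phi> = "g \<circ> inv_into D h"
  show *: "?\<phi> (h i) = g i" if "i \<in> D" for i
    using assms(2) that by (simp add: bij_betw_inv_into_left)
  show "strict_mono_on A ?\<phi>"
  proof (rule strict_mono_onI)
    fix a b assume "a \<in> A" "b \<in> A" "a < b"
    then obtain i j where "i \<in> D" "j \<in> D" "a = h i" "b = h j"
      using assms(2) by (auto simp: bij_betw_def)
    then show "?\<phi> a < ?\<phi> b"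
      using * \<open>a < b\<close> assms(1) by (simp add: uniform_listings_def del: comp_apply)
  qed
  show "?\<phi> ` A = B"
    using assms(2,3) bij_betw_inv_into[OF assms(2)] by (metis bij_betw_def image_comp)
qed

section \<open>The two sets, their enumerability and one-one equivalence\<close>

text \<open>Both members of the pair \<open>2 * n + 2\<close>, \<open>2 * n + 3\<close> give
  \<open>x div 2 - 1 = n\<close>. Starting at 2 keeps the pairs positive; 1 is unpaired and outside
  the set.\<close>

definition even_with :: "nat set \<Rightarrow> nat set" where
  "even_with K = {x. 2 \<le> x \<and> (even x \<or> x div 2 - 1 \<in> K)}"

definition odd_with :: "nat set \<Rightarrow> nat set" where
  "odd_with K = {x. 2 \<le> x \<and> (odd x \<or> x div 2 - 1 \<in> K)}"

text \<open>The indicators turn the case distinction into arithmetic, for which closure rules are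
  available; 0 and 1 are fixed.\<close>

definition swap_pairs :: "nat \<Rightarrow> nat" where
  "swap_pairs x = x + of_bool (2 \<le> x \<and> even x) - of_bool (2 \<le> x \<and> odd x)"

lemma swap_pairs_one: "swap_pairs 1 = 1"
  by (simp add: swap_pairs_def)

lemma computable_swap_pairs: "computable swap_pairs"
proof -
  have "decidable (\<lambda>x. 1 < x \<and> even x)" "decidable (\<lambda>x. 1 < x \<and> odd x)"
    by (intro computable_intros)+
  then have "computable (\<lambda>x. x + of_bool (1 < x \<and> even x) - of_bool (1 < x \<and> odd x))"
    unfolding decidable_def by (intro computable_intros)
  moreover have "2 \<le> x \<longleftrightarrow> 1 < x" for x :: nat
    by auto
  ultimately show ?thesis
    unfolding swap_pairs_def[abs_def] by simp
qed

lemma swap_pairs_even: "swap_pairs (2 * n + 2) = 2 * n + 3"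
  by (simp add: swap_pairs_def)

lemma swap_pairs_odd: "swap_pairs (2 * n + 3) = 2 * n + 2"
  by (simp add: swap_pairs_def)

lemma pos_pair_cases:
  fixes x :: nat
  assumes "x \<ge> 1"
  obtains "x = 1" | n where "x = 2 * n + 2" | n where "x = 2 * n + 3"
proof (cases "x = 1")
  case False
  show ?thesis
  proof (cases "even x")
    case True
    with assms have "x = 2 * (x div 2 - 1) + 2" by presburger
    then show ?thesis by (rule that(2))
  next
    case odd: False
    with assms False have "x = 2 * (x div 2 - 1) + 3" by presburger
    then show ?thesis by (rule that(3))
  qed
qed (rule that(1))

lemma even_with_iff:
  "0 \<notin> even_with K" "1 \<notin> even_with K" "2 * n + 2 \<in> even_with K" "2 * n + 3 \<in> even_with K \<longleftrightarrow> n \<in> K"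
  by (auto simp: even_with_def)

lemma odd_with_iff:
  "0 \<notin> odd_with K" "1 \<notin> odd_with K" "2 * n + 2 \<in> odd_with K \<longleftrightarrow> n \<in> K" "2 * n + 3 \<in> odd_with K"
  by (auto simp: odd_with_def)

lemma even_with_cases [consumes 1, case_names even odd]:
  assumes "x \<in> even_with K"
  obtains n where "x = 2 * n + 2" | n where "x = 2 * n + 3" "n \<in> K"
proof -
  have "x \<ge> 1" using assms by (simp add: even_with_def)
  then show ?thesis
    by (rule pos_pair_cases) (use assms that even_with_iff in blast)+
qed

lemma infinite_even_with: "infinite (even_with K)"
proof -
  have "(\<lambda>n. 2 * n + 2) ` UNIV \<subseteq> even_with K"
    by (auto simp: even_with_def)
  then show ?thesis
    by (rule infinite_super) (simp add: finite_image_iff inj_on_def)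
qed

lemma infinite_odd_with: "infinite (odd_with K)"
proof -
  have "(\<lambda>n. 2 * n + 3) ` UNIV \<subseteq> odd_with K"
    by (auto simp: odd_with_def)
  then show ?thesis
    by (rule infinite_super) (simp add: finite_image_iff inj_on_def)
qed

lemma re_set_even_with_odd_with:
  assumes "decidable (\<lambda>y. R (pfst y) (psnd y))"
  shows "re_set (even_with {x. \<exists>n. R n x})" "re_set (odd_with {x. \<exists>n. R n x})"
proof -
  \<comment> \<open>The second argument is replaced by precomposing with a computable recoding of
    pairs.\<close>
  have R: "decidable (\<lambda>y. R (pfst y) (psnd y div 2 - 1))"
    using computable_comp[OF assms[unfolded decidable_def],
        of "\<lambda>y. prod_encode (pfst y, psnd y div 2 - 1)"]
    unfolding decidable_def by simp (rule meta_mp, assumption, intro computable_intros)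
  \<comment> \<open>The search quantifier is moved to the front; where parity alone decides
    membership, any \<open>n\<close> is a witness.\<close>
  have "even_with {x. \<exists>n. R n x} = {x. \<exists>n. 1 < x \<and> (even x \<or> R n (x div 2 - 1))}"
    "odd_with {x. \<exists>n. R n x} = {x. \<exists>n. 1 < x \<and> (odd x \<or> R n (x div 2 - 1))}"
    by (auto simp: even_with_def odd_with_def)
  moreover have "decidable (\<lambda>y. 1 < psnd y \<and> (even (psnd y) \<or> R (pfst y) (psnd y div 2 - 1)))"
    "decidable (\<lambda>y. 1 < psnd y \<and> (odd (psnd y) \<or> R (pfst y) (psnd y div 2 - 1)))"
    by (intro computable_intros R)+
  note this[THEN domain_semidecidable]
  ultimately show "re_set (even_with {x. \<exists>n. R n x})" "re_set (odd_with {x. \<exists>n. R n x})"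
    unfolding re_set_def by (auto simp: even_with_def odd_with_def)
qed

lemma computable_imp_computable_on_PosNat:
  assumes "computable f"
  shows "computable_on PosNat f"
proof -
  have "decidable (\<lambda>y. 0 < psnd y)"
    by (intro computable_intros)
  from computable_on_semidecidable[OF assms this] show ?thesis
    by (simp add: atLeast_def Suc_le_eq)
qed

lemma swap_pairs_even_with_odd_with:
  assumes "x \<in> PosNat"
  shows "x \<in> even_with K \<longleftrightarrow> swap_pairs x \<in> odd_with K"
    and "x \<in> odd_with K \<longleftrightarrow> swap_pairs x \<in> even_with K"
    and "swap_pairs x \<in> PosNat"
    and "swap_pairs (swap_pairs x) = x"
proof -
  have "x \<ge> 1" using assms by simp
  then have "(x \<in> even_with K \<longleftrightarrow> swap_pairs x \<in> odd_with K) \<and>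
      (x \<in> odd_with K \<longleftrightarrow> swap_pairs x \<in> even_with K) \<and>
      swap_pairs x \<ge> 1 \<and> swap_pairs (swap_pairs x) = x"
    by (rule pos_pair_cases)
      (simp_all only: even_with_iff odd_with_iff swap_pairs_one swap_pairs_even swap_pairs_odd, simp_all)
  then show "x \<in> even_with K \<longleftrightarrow> swap_pairs x \<in> odd_with K"
    and "x \<in> odd_with K \<longleftrightarrow> swap_pairs x \<in> even_with K"
    and "swap_pairs x \<in> PosNat" and "swap_pairs (swap_pairs x) = x"
    by auto
qed

lemma even_with_one_equivalent_odd_with: "even_with K \<equiv>\<^sub>1 odd_with K"
proof -
  have "inj_on swap_pairs PosNat"
    using swap_pairs_even_with_odd_with(4) by (rule inj_on_inverseI)
  then show ?thesis
    unfolding one_equivalent_def one_reducible_def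
    using computable_imp_computable_on_PosNat[OF computable_swap_pairs] swap_pairs_even_with_odd_with
    by (intro conjI exI[of _ swap_pairs]) blast+
qed

section \<open>The order isomorphism and the complement of \<open>K\<close>\<close>

text \<open>Both sets contain equally many members of each pair: two if \<open>n \<in> K\<close>,
  otherwise one. Matching them pair by pair gives an explicit isomorphism, and uniqueness identifies
  \<phi> with it.\<close>

lemma strict_mono_even_with_odd_with:
  assumes \<phi>: "strict_mono_on (even_with K) \<phi>" "\<phi> ` even_with K = odd_with K"
  shows "n \<in> K \<longleftrightarrow> \<phi> (2 * n + 2) \<noteq> 2 * n + 3"
proof -
  define \<psi> where "\<psi> x = (if even x \<and> x div 2 - 1 \<notin> K then Suc x else x)" for x
  have \<psi>: "\<psi> (2 * n + 2) = (if n \<in> K then 2 * n + 2 else 2 * n + 3)" "\<psi> (2 * n + 3) = 2 * n + 3" for n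
    by (simp_all add: \<psi>_def)
  have "strict_mono_on (even_with K) \<psi>"
  proof (rule strict_mono_onI)
    fix x y assume xy: "x \<in> even_with K" "y \<in> even_with K" "x < y"
    from xy(1) show "\<psi> x < \<psi> y"
    proof (cases rule: even_with_cases)
      case x: (even n)
      from xy(2) show ?thesis
      proof (cases rule: even_with_cases)
        case (even m)
        with x xy(3) have "n < m" by simp
        with x even show ?thesis by (simp_all only: \<psi>, auto)
      next
        case (odd m)
        \<comment> \<open>The critical case is \<open>m = n\<close>: both members of the pair are
          then present, so \<open>n \<in> K\<close> and \<open>2 * n + 2\<close> stays
          fixed.\<close>
        with x xy(3) have "n < m \<or> n \<in> K" by (cases "n = m") auto
        with x odd xy(3) show ?thesis by (simp_all only: \<psi>, auto)
      qed
    next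
      case (odd n)
      from xy(2) show ?thesis
        by (cases rule: even_with_cases)
          (use odd xy(3) in \<open>simp_all only: \<psi>, auto\<close>)
    qed
  qed
  moreover have "\<psi> ` even_with K = odd_with K"
  proof (intro subset_antisym subsetI)
    fix y assume "y \<in> \<psi> ` even_with K"
    then obtain x where x: "x \<in> even_with K" "y = \<psi> x" by blast
    from x(1) show "y \<in> odd_with K"
      by (cases rule: even_with_cases) (simp_all only: x(2) \<psi> odd_with_iff split: if_split, simp)
  next
    fix y assume y: "y \<in> odd_with K"
    then have "y \<ge> 1" by (simp add: odd_with_def)
    then show "y \<in> \<psi> ` even_with K"
    proof (cases rule: pos_pair_cases)
      case 1
      with y odd_with_iff(2) show ?thesis by blast
    next
      case (2 n)
      with y have "n \<in> K" using odd_with_iff(3) by blast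
      with 2 show ?thesis
        by (intro image_eqI[OF _ even_with_iff(3)[of n]]) (simp only: \<psi> if_True)
    next
      case (3 n)
      show ?thesis
      proof (cases "n \<in> K")
        case True
        then show ?thesis
          by (intro image_eqI[of _ _ "2 * n + 3"]) (simp_all only: 3 \<psi> even_with_iff)
      next
        case False
        with 3 show ?thesis
          by (intro image_eqI[OF _ even_with_iff(3)[of n]]) (simp only: \<psi> if_False)
      qed
    qed
  qed
  ultimately have "\<phi> (2 * n + 2) = \<psi> (2 * n + 2)"
    using \<phi> even_with_iff(3) by (intro strict_mono_on_image_unique[of "even_with K"]) auto
  then show ?thesis unfolding \<psi> by simp
qed

text \<open>Composing with \<open>Succ\<close> makes a function given on positive arguments total on
  \<open>nat\<close>, where the closure rules apply.\<close>

lemma computable_on_PosNat_Suc: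
  assumes "computable_on PosNat h"
  shows "computable (\<lambda>i. h (Suc i))"
proof -
  obtain p where p: "evaluates p [x] y \<longleftrightarrow> x \<in> PosNat \<and> y = h x" for x y
    using assms unfolding computable_on_def by blast
  have "evaluates (Comp p [Succ]) [i] (h (Suc i))" for i
    by (rule evaluates_Comp1[OF evaluates.succ]) (simp add: p)
  then show ?thesis unfolding computable_def by blast
qed

text \<open>To confirm \<open>n \<notin> K\<close>, search for the index at which \<open>h\<close>
  lists \<open>2 * n + 2\<close> and check that \<open>g\<close> lists \<open>2 * n + 3\<close>
  there. This semidecides the complement, which is what the diagonal argument refutes for the
  halting set.\<close>

lemma uniform_imp_complement_domain:
  assumes "even_with K \<sim> odd_with K"
  shows "\<exists>p. - K = {x. \<exists>y. evaluates p [x] y}"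
proof -
  have "listing_domain (even_with K) = PosNat" "listing_domain (odd_with K) = PosNat"
    using infinite_even_with infinite_odd_with by (auto simp: listing_domain_def)
  with assms obtain h g where h: "bij_betw h PosNat (even_with K)" "computable_on PosNat h"
    and g: "bij_betw g PosNat (odd_with K)" "computable_on PosNat g"
    and hg: "uniform_listings PosNat h g"
    unfolding uniform_def is_listing_def by auto
  obtain \<phi> where \<phi>: "strict_mono_on (even_with K) \<phi>" "\<phi> ` even_with K = odd_with K"
    and \<phi>_h: "\<And>i. i \<in> PosNat \<Longrightarrow> \<phi> (h i) = g i"
    using uniform_listings_strict_mono[OF hg h(1) g(1)] by blast
  let ?R = "\<lambda>i n. h (Suc i) = 2 * n + 2 \<and> g (Suc i) = 2 * n + 3"
  have "n \<notin> K \<longleftrightarrow> (\<exists>i. ?R i n)" for n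
  proof -
    have "2 * n + 2 \<in> h ` PosNat"
      using h(1) even_with_iff(3) by (simp add: bij_betw_def)
    then obtain i where "h (Suc i) = 2 * n + 2"
      by (auto simp: Suc_le_eq gr0_conv_Suc)
    moreover have "\<phi> (h (Suc j)) = g (Suc j)" for j
      by (rule \<phi>_h) simp
    ultimately show ?thesis
      using strict_mono_even_with_odd_with[OF \<phi>, of n] by metis
  qed
  then have "- K = {n. \<exists>i. ?R i n}"
    by blast
  moreover have "decidable (\<lambda>y. ?R (pfst y) (psnd y))"
    by (intro computable_intros computable_comp[OF computable_on_PosNat_Suc[OF h(2)]]
        computable_comp[OF computable_on_PosNat_Suc[OF g(2)]])
  ultimately show ?thesis
    using domain_semidecidable by simp
qed

theorem proposition3p3:
  "\<exists>A B :: nat set. re_set A \<and> re_set B \<and> A \<equiv>\<^sub>1 B \<and> \<not> A \<sim> B"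
proof -
  let ?K = "{x. \<exists>s. halts_by s x}"
  have "decidable (\<lambda>y. halts_by (pfst y) (psnd y))"
    by (intro decidable_halts_by computable_intros)
  from re_set_even_with_odd_with[OF this]
  have "re_set (even_with ?K)" "re_set (odd_with ?K)" .
  moreover have "\<not> even_with ?K \<sim> odd_with ?K"
    using uniform_imp_complement_domain halts_complement_not_domain
    by (metis Collect_neg_eq)
  ultimately show ?thesis
    using even_with_one_equivalent_odd_with by blast
qed

end
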